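(* Let $n \ge 1$, let $\omega$ be a state on $M_n(\mathbb{C})$, let $1 \le p \le 2$ and let $A \in M_n(\mathbb{C})$. Then $$\omega\bigl(|A - \omega(A) I_n|^p\bigr)^{1/p} \;\le\; \min_{\lambda \in \mathbb{C}} \|A - \lambda I_n\| .$$
   Context: $M_n(\mathbb{C})$ is the algebra of $n\times n$ complex matrices, $I_n$ is the identity matrix, and $\|\cdot\|$ is the operator (spectral) norm. A state is a positive linear functional $\omega$ of norm $1$, i.e. $\omega(A) = \mathrm{Tr}(DA)$ for some positive semidefinite $D$ with $\mathrm{Tr}\,D = 1$. For $B \in M_n(\mathbb{C})$, $|B| = (B^*B)^{1/2}$. *)

theory Defs
  imports "HOL-Analysis.Analysis"
begin

definition mat_adj :: "complex^'n^'m \<Rightarrow> complex^'m^'n" where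
  "mat_adj A = map_matrix cnj (transpose A)"

definition unitary_mat :: "complex^'n^'n \<Rightarrow> bool" where
  "unitary_mat U \<longleftrightarrow> mat_adj U ** U = mat 1 \<and> U ** mat_adj U = mat 1"

definition diag_mat :: "('n \<Rightarrow> real) \<Rightarrow> complex^'n^'n" where
  "diag_mat d = (\<chi> i j. if i = j then complex_of_real (d i) else 0)"

text \<open>Over the complex numbers, having a real nonnegative quadratic form already forces
  the matrix to be Hermitian.\<close>

definition psd_mat :: "complex^'n^'n \<Rightarrow> bool" where
  "psd_mat A \<longleftrightarrow> (\<forall>x. (\<Sum>i\<in>UNIV. cnj (x $ i) * (A *v x) $ i) \<in> \<real>\<^sub>\<ge>\<^sub>0)"

text \<open>The operator norm induced by the Euclidean norm on \<open>complex^'n\<close>.\<close>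

definition op_norm :: "complex^'n^'n \<Rightarrow> real" where
  "op_norm A = onorm ((*v) A)"

text \<open>\<open>psd_powr_rel H r P\<close>: the matrix \<open>P\<close> is \<open>H\<^sup>r\<close>, computed in some unitary diagonalization of the
  positive semidefinite matrix \<open>H\<close>. Since \<open>0 powr r = 0\<close> for every \<open>r\<close>, this is the continuous
  functional calculus for \<open>t \<mapsto> t\<^sup>r\<close> only when \<open>r > 0\<close>.\<close>

definition psd_powr_rel :: "complex^'n^'n \<Rightarrow> real \<Rightarrow> complex^'n^'n \<Rightarrow> bool" where
  "psd_powr_rel H r P \<longleftrightarrow>
     (\<exists>U d. unitary_mat U \<and> (\<forall>i. 0 \<le> d i) \<and> H = U ** diag_mat d ** mat_adj U \<and>
            P = U ** diag_mat (\<lambda>i. d i powr r) ** mat_adj U)"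

lemma mult_diag_mat: "(A ** diag_mat d) $ i $ j = A $ i $ j * complex_of_real (d j)"
  by (simp add: matrix_matrix_mult_def diag_mat_def if_distrib cong: if_cong)

lemma diag_mat_mult: "(diag_mat d ** A) $ i $ j = complex_of_real (d i) * A $ i $ j"
  by (simp add: matrix_matrix_mult_def diag_mat_def if_distrib if_distribR cong: if_cong)

lemma psd_powr_rel_unique:
  assumes "psd_powr_rel H r P" and "psd_powr_rel H r Q"
  shows "P = Q"
proof -
  obtain U d where U: "unitary_mat U" and HU: "H = U ** diag_mat d ** mat_adj U"
    and P: "P = U ** diag_mat (\<lambda>i. d i powr r) ** mat_adj U"
    using assms(1) unfolding psd_powr_rel_def by blast
  obtain V e where V: "unitary_mat V" and HV: "H = V ** diag_mat e ** mat_adj V"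
    and Q: "Q = V ** diag_mat (\<lambda>i. e i powr r) ** mat_adj V"
    using assms(2) unfolding psd_powr_rel_def by blast
  have UU: "mat_adj U ** U = mat 1" "U ** mat_adj U = mat 1"
    and VV: "mat_adj V ** V = mat 1" "V ** mat_adj V = mat 1"
    using U V by (auto simp: unitary_mat_def)
  define W where "W = mat_adj V ** U"
  have "mat_adj V ** H ** U = W ** diag_mat d ** (mat_adj U ** U)"
    by (simp only: HU W_def matrix_mul_assoc)
  moreover have "mat_adj V ** H ** U = (mat_adj V ** V) ** diag_mat e ** W"
    by (simp only: HV W_def matrix_mul_assoc)
  ultimately have "W ** diag_mat d = diag_mat e ** W"
    by (simp add: UU VV)
  then have "W $ i $ j * complex_of_real (d j) = complex_of_real (e i) * W $ i $ j" for i j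
    by (metis mult_diag_mat diag_mat_mult)
  then have "W $ i $ j = 0 \<or> d j = e i" for i j
    by (metis mult.commute mult_cancel_left of_real_eq_iff)
  then have "W $ i $ j * complex_of_real (d j powr r)
      = complex_of_real (e i powr r) * W $ i $ j" for i j
    by (metis mult.commute mult_zero_left)
  then have "W ** diag_mat (\<lambda>i. d i powr r) = diag_mat (\<lambda>i. e i powr r) ** W"
    by (simp add: vec_eq_iff mult_diag_mat diag_mat_mult)
  then have "V ** (W ** diag_mat (\<lambda>i. d i powr r)) ** mat_adj U
      = V ** (diag_mat (\<lambda>i. e i powr r) ** W) ** mat_adj U"
    by simp
  then have "(V ** mat_adj V) ** (U ** diag_mat (\<lambda>i. d i powr r) ** mat_adj U)
      = V ** diag_mat (\<lambda>i. e i powr r) ** mat_adj V ** (U ** mat_adj U)"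
    by (simp only: W_def matrix_mul_assoc)
  then show ?thesis
    by (simp add: UU VV P Q)
qed

definition psd_powr :: "complex^'n^'n \<Rightarrow> real \<Rightarrow> complex^'n^'n" where
  "psd_powr H r = (THE P. psd_powr_rel H r P)"

definition mat_abs :: "complex^'n^'n \<Rightarrow> complex^'n^'n" where
  "mat_abs B = psd_powr (mat_adj B ** B) (1/2)"

text \<open>Complex linearity is linearity for entrywise multiplication by complex scalars; the last
  conjunct is the dual norm with respect to \<open>op_norm\<close>.\<close>

definition is_state :: "(complex^'n^'n \<Rightarrow> complex) \<Rightarrow> bool" where
  "is_state \<omega> \<longleftrightarrow>
     Vector_Spaces.linear (\<lambda>c. map_matrix ((*) c)) (*) \<omega> \<and>
     (\<forall>A. psd_mat A \<longrightarrow> \<omega> A \<in> \<real>\<^sub>\<ge>\<^sub>0) \<and>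
     (SUP A\<in>{A. op_norm A \<le> 1}. cmod (\<omega> A)) = 1"

end

theory Submission
  imports Defs
begin

text \<open>For \<open>p = 2\<close> the left-hand side is the standard deviation of \<open>A\<close> in the state \<open>\<omega>\<close>. The
  function \<open>c \<mapsto> \<omega>((A - c)\<^sup>*(A - c))\<close> equals its value at \<open>c = \<omega>(A)\<close> plus \<open>|c - \<omega>(A)|\<^sup>2\<close>, and it is
  at most \<open>\<parallel>A - c\<parallel>\<^sup>2\<close> because \<open>\<omega>\<close> is positive and unital. For \<open>p < 2\<close>, diagonalize \<open>|B|\<^sup>2\<close> for
  \<open>B = A - \<omega>(A)\<close>: on the diagonal algebra \<open>\<omega>\<close> is a probability measure, so Jensen's inequality bounds
  the \<open>p\<close>-mean of \<open>|B|\<close> by its quadratic mean. That \<open>\<omega>\<close> is unital follows from its norm being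
  \<open>1\<close> and the Cauchy--Schwarz inequality.\<close>

section \<open>Inner product, adjoint and positive semidefiniteness\<close>

definition cip :: "complex^'n \<Rightarrow> complex^'n \<Rightarrow> complex" where
  "cip x y = (\<Sum>i\<in>UNIV. cnj (x $ i) * y $ i)"

lemma psd_mat_cip: "psd_mat A \<longleftrightarrow> (\<forall>x. cip x (A *v x) \<in> \<real>\<^sub>\<ge>\<^sub>0)"
  by (simp add: psd_mat_def cip_def)

lemma cip_diff_right: "cip x (y - z) = cip x y - cip x z"
  by (simp add: cip_def algebra_simps sum_subtractf)

lemma cip_scale_right: "cip x (c *s y) = c * cip x y"
  by (simp add: cip_def sum_distrib_left algebra_simps)

lemma cip_scale_left: "cip (c *s x) y = cnj c * cip x y"
  by (simp add: cip_def sum_distrib_left algebra_simps)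

lemma cip_commute: "cip y x = cnj (cip x y)"
  by (simp add: cip_def mult.commute)

lemma Re_cip: "Re (cip x y) = x \<bullet> y"
  by (simp add: cip_def inner_vec_def inner_complex_def)

lemma cip_self: "cip x x = complex_of_real ((norm x)\<^sup>2)"
proof (rule complex_eqI)
  show "Re (cip x x) = Re (complex_of_real ((norm x)\<^sup>2))"
    by (simp add: Re_cip power2_norm_eq_inner)
  show "Im (cip x x) = Im (complex_of_real ((norm x)\<^sup>2))"
    by (simp add: cip_def mult.commute)
qed

lemma mat_adj_nth: "mat_adj A $ i $ j = cnj (A $ j $ i)"
  by (simp add: mat_adj_def map_matrix_def transpose_def)

lemma cip_mat_adj: "cip x (mat_adj A *v y) = cip (A *v x) y"
proof -
  have "cip x (mat_adj A *v y) = (\<Sum>i\<in>UNIV. \<Sum>j\<in>UNIV. cnj (x $ i) * (cnj (A $ j $ i) * y $ j))"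
    by (simp add: cip_def matrix_vector_mult_def mat_adj_nth sum_distrib_left)
  also have "\<dots> = (\<Sum>j\<in>UNIV. \<Sum>i\<in>UNIV. cnj (x $ i) * (cnj (A $ j $ i) * y $ j))"
    by (rule sum.swap)
  also have "\<dots> = cip (A *v x) y"
    by (simp add: cip_def matrix_vector_mult_def sum_distrib_right sum_distrib_left mult_ac)
  finally show ?thesis .
qed

lemma cip_gram: "cip x ((mat_adj B ** B) *v y) = cip (B *v x) (B *v y)"
  by (simp add: cip_mat_adj flip: matrix_vector_mul_assoc)

lemma psd_mat_gram: "psd_mat (mat_adj B ** B)"
  by (simp add: psd_mat_cip cip_gram cip_self)

section \<open>Unitary diagonalization of \<open>mat_adj B ** B\<close> and powers of
  \<open>mat_abs B\<close>\<close>

lemma scaleR_eq_vector_scale: "t *\<^sub>R (x :: complex^'n) = complex_of_real t *s x"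
  unfolding vec_eq_iff vector_scaleR_component vector_smult_component
  by (simp add: scaleR_conv_of_real)

lemma exists_unit_vector_orthogonal:
  fixes v :: "'n::finite \<Rightarrow> complex^'n"
  assumes "k \<notin> K"
  obtains x where "norm x = 1" and "\<And>j. j \<in> K \<Longrightarrow> cip (v j) x = 0"
proof -
  \<comment> \<open>The \<open>k\<close>-th row of this matrix vanishes, so it has a nontrivial kernel.\<close>
  define M :: "complex^'n^'n" where "M = (\<chi> j i. if j \<in> K then cnj (v j $ i) else 0)"
  have "M ** N \<noteq> mat 1" for N
  proof
    assume "M ** N = mat 1"
    then have "(M ** N) $ k $ k = (mat 1 :: complex^'n^'n) $ k $ k" by simp
    then show False
      using assms by (simp add: M_def matrix_matrix_mult_def mat_def)
  qed
  then have "\<nexists>N. N ** M = mat 1"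
    by (metis matrix_left_right_inverse)
  then obtain x where x: "M *v x = 0" "x \<noteq> 0"
    using matrix_left_invertible_ker by blast
  have "cip (v j) x = 0" if "j \<in> K" for j
    using arg_cong[OF x(1), of "\<lambda>y. y $ j"] that
    by (simp add: M_def cip_def matrix_vector_mult_def)
  moreover have "cip (v j) (x /\<^sub>R norm x) = complex_of_real (1 / norm x) * cip (v j) x" for j
    by (simp add: scaleR_eq_vector_scale cip_scale_right divide_simps)
  ultimately show ?thesis
    using that[of "x /\<^sub>R norm x"] x(2) by simp
qed

text \<open>Rayleigh quotient argument: \<open>H\<close> is self-adjoint and the \<open>v j\<close>
  are eigenvectors, so \<open>H\<close> maps their orthogonal complement \<open>W\<close> into
  itself. The unit sphere of \<open>W\<close> is compact and nonempty, and a maximizer of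
  \<open>(norm (B *v x))\<^sup>2\<close> on it is an eigenvector with the maximum as
  eigenvalue.\<close>

lemma exists_eigenvector_orthogonal:
  fixes v :: "'n::finite \<Rightarrow> complex^'n" and B :: "complex^'n^'n"
  assumes k: "k \<notin> K"
    and eig: "\<And>j. j \<in> K \<Longrightarrow> (mat_adj B ** B) *v v j = complex_of_real (d j) *s v j"
  obtains x m where "norm x = 1" and "\<And>j. j \<in> K \<Longrightarrow> cip (v j) x = 0"
    and "0 \<le> m" and "(mat_adj B ** B) *v x = complex_of_real m *s x"
proof -
  define W where "W = {x. \<forall>j\<in>K. cip (v j) x = 0}"
  define H where "H = mat_adj B ** B"
  have W_diff: "x - y \<in> W" if "x \<in> W" "y \<in> W" for x y
    using that by (simp add: W_def cip_diff_right)
  have W_scale: "c *s x \<in> W" if "x \<in> W" for c x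
    using that by (simp add: W_def cip_scale_right)
  have H_symm: "cip (H *v x) y = cip x (H *v y)" for x y
    unfolding H_def by (metis cip_gram cip_commute)
  have W_H: "H *v x \<in> W" if "x \<in> W" for x
  proof -
    have "cip (v j) (H *v x) = 0" if "j \<in> K" for j
      using eig[OF that] \<open>x \<in> W\<close> that
      by (simp add: W_def cip_scale_left flip: H_symm H_def)
    then show ?thesis by (simp add: W_def)
  qed
  have "closed W"
  proof -
    have "W = (\<Inter>j\<in>K. {x. cip (v j) x = 0})" by (auto simp: W_def)
    moreover have "closed {x. cip (v j) x = 0}" for j
      unfolding cip_def by (intro closed_Collect_eq continuous_intros)
    ultimately show ?thesis by auto
  qed
  then have "compact (W \<inter> sphere 0 1)"
    by (simp add: closed_Int_compact)
  moreover have "W \<inter> sphere 0 1 \<noteq> {}"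
  proof -
    obtain y where "norm y = 1" "\<And>j. j \<in> K \<Longrightarrow> cip (v j) y = 0"
      using exists_unit_vector_orthogonal[OF k, of v] by metis
    then have "y \<in> W \<inter> sphere 0 1" by (simp add: W_def)
    then show ?thesis by blast
  qed
  moreover have "continuous_on (W \<inter> sphere 0 1) (\<lambda>x. (norm (B *v x))\<^sup>2)"
    by (intro continuous_intros linear_continuous_on matrix_vector_mul_bounded_linear)
  ultimately obtain x where "x \<in> W \<inter> sphere 0 1"
    and "\<forall>y\<in>W \<inter> sphere 0 1. (norm (B *v y))\<^sup>2 \<le> (norm (B *v x))\<^sup>2"
    using continuous_attains_sup[of "W \<inter> sphere 0 1" "\<lambda>x. (norm (B *v x))\<^sup>2"] by blast
  then have x: "x \<in> W" "norm x = 1"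
    and max: "\<And>y. y \<in> W \<Longrightarrow> norm y = 1 \<Longrightarrow> (norm (B *v y))\<^sup>2 \<le> (norm (B *v x))\<^sup>2"
    by (simp_all add: Ball_def)
  define m where "m = (norm (B *v x))\<^sup>2"
  \<comment> \<open>Homogeneity carries the maximality from the unit sphere of \<open>W\<close> to
    all of \<open>W\<close>.\<close>
  have bound: "(norm (B *v y))\<^sup>2 \<le> m * (norm y)\<^sup>2" if "y \<in> W" for y
  proof (cases "y = 0")
    case False
    have "(norm (B *v (y /\<^sub>R norm y)))\<^sup>2 \<le> m"
      unfolding m_def
    proof (rule max)
      show "y /\<^sub>R norm y \<in> W" by (simp add: scaleR_eq_vector_scale W_scale that)
      show "norm (y /\<^sub>R norm y) = 1" using False by simp
    qed
    moreover have "B *v (y /\<^sub>R norm y) = (B *v y) /\<^sub>R norm y"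
      by (simp add: scaleR_eq_vector_scale matrix_vector_mult_scaleR vec.scale)
    ultimately show ?thesis
      using False by (simp add: power_mult_distrib power_inverse field_simps)
  qed simp
  \<comment> \<open>\<open>x\<close> minimizes the form \<open>g\<close> below on \<open>W\<close>, and half the derivative of \<open>g\<close> at \<open>x\<close> in direction \<open>z\<close> is
      \<open>\<parallel>z\<parallel>\<^sup>2\<close>; hence \<open>z = 0\<close>.\<close>
  define z where "z = m *\<^sub>R x - H *v x"
  have zW: "z \<in> W"
    using x W_H by (simp add: z_def scaleR_eq_vector_scale[of _ x] W_diff W_scale)
  define g where "g y = m * (norm y)\<^sup>2 - (norm (B *v y))\<^sup>2" for y
  have inner_H: "a \<bullet> (H *v b) = (B *v a) \<bullet> (B *v b)" for a b
    using arg_cong[OF cip_gram, of Re a B b] by (simp add: Re_cip H_def)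
  have "g (x - t *\<^sub>R z) = t\<^sup>2 * g z - 2 * t * (norm z)\<^sup>2" for t
  proof -
    have Bt: "B *v (x - t *\<^sub>R z) = B *v x - t *\<^sub>R (B *v z)"
      by (simp add: scaleR_eq_vector_scale vec.diff vec.scale)
    have "g (x - t *\<^sub>R z) = g x + t\<^sup>2 * g z - 2 * t * (m * (z \<bullet> x) - (B *v z) \<bullet> (B *v x))"
      unfolding g_def Bt power2_norm_eq_inner
      by (simp add: inner_diff_left inner_diff_right inner_commute algebra_simps power2_eq_square)
    moreover have "g x = 0" using x by (simp add: g_def m_def)
    moreover have "m * (z \<bullet> x) - (B *v z) \<bullet> (B *v x) = (norm z)\<^sup>2"
      by (simp add: inner_H[symmetric] power2_norm_eq_inner z_def inner_diff_right)
    ultimately show ?thesis by simp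
  qed
  moreover have "g (x - t *\<^sub>R z) \<ge> 0" for t
    using bound[of "x - t *\<^sub>R z"] x zW by (simp add: g_def scaleR_eq_vector_scale[of t z] W_diff W_scale)
  ultimately have quad: "2 * t * (norm z)\<^sup>2 \<le> t\<^sup>2 * g z" for t
    by (smt (verit))
  have "(norm z)\<^sup>2 = 0"
  proof (rule ccontr)
    assume "(norm z)\<^sup>2 \<noteq> 0"
    then have pos: "(norm z)\<^sup>2 > 0" by simp
    moreover have "2 * (norm z)\<^sup>2 \<le> g z" using quad[of 1] by simp
    ultimately have "g z > 0" by linarith
    \<comment> \<open>With \<open>N = (norm z)\<^sup>2\<close>, the choice
      \<open>t = N / g z\<close> in \<open>quad\<close> gives
      \<open>2 * N\<^sup>2 / g z \<le> N\<^sup>2 / g z\<close>, although both \<open>N\<close> and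
      \<open>g z\<close> are positive.\<close>
    then show False using quad[of "(norm z)\<^sup>2 / g z"] mult_pos_pos[OF pos pos]
      by (simp add: power2_eq_square field_simps)
  qed
  then have "H *v x = complex_of_real m *s x"
    by (simp add: z_def scaleR_eq_vector_scale)
  then show ?thesis
    using that[of x m] x by (simp add: m_def W_def H_def)
qed

text \<open>Induction on the index set adds one eigenvector at a time, orthogonal to those already
  found; \<open>K = UNIV\<close> yields an orthonormal eigenbasis.\<close>

lemma exists_orthonormal_eigenvectors:
  fixes B :: "complex^'n^'n" and K :: "'n set"
  shows "\<exists>v d. (\<forall>j\<in>K. 0 \<le> d j \<and> (mat_adj B ** B) *v v j = complex_of_real (d j) *s v j)
     \<and> (\<forall>i\<in>K. \<forall>j\<in>K. cip (v i) (v j) = (if i = j then 1 else 0))"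
  using finite[of K]
proof (induction K)
  case (insert k K)
  then obtain v :: "'n \<Rightarrow> complex^'n" and d where
    d: "\<And>j. j \<in> K \<Longrightarrow> 0 \<le> d j \<and> (mat_adj B ** B) *v v j = complex_of_real (d j) *s v j"
    and v: "\<And>i j. i \<in> K \<Longrightarrow> j \<in> K \<Longrightarrow> cip (v i) (v j) = (if i = j then 1 else 0)"
    by metis
  obtain x m where x: "norm x = 1" "\<And>j. j \<in> K \<Longrightarrow> cip (v j) x = 0"
    "0 \<le> m" "(mat_adj B ** B) *v x = complex_of_real m *s x"
    using exists_eigenvector_orthogonal[OF insert.hyps(2), of B v d] d by metis
  have "cip x (v j) = 0" if "j \<in> K" for j
    using x(2)[OF that] by (metis cip_commute complex_cnj_zero)
  moreover have "cip x x = 1" using x(1) by (simp add: cip_self)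
  ultimately show ?case
    using insert.hyps(2) d v x
    by (intro exI[of _ "v(k := x)"] exI[of _ "d(k := m)"]) auto
qed simp

text \<open>The eigenvectors become the columns of \<open>U\<close>: orthonormality is
  \<open>mat_adj U ** U = mat 1\<close>, and the other unitarity equation follows because
  \<open>U\<close> is square.\<close>

lemma gram_diagonalization:
  fixes B :: "complex^'n^'n"
  obtains U d where "unitary_mat U" and "\<And>i. 0 \<le> d i"
    and "mat_adj B ** B = U ** diag_mat d ** mat_adj U"
proof -
  obtain v :: "'n \<Rightarrow> complex^'n" and d where
    "\<forall>j\<in>UNIV. 0 \<le> d j \<and> (mat_adj B ** B) *v v j = complex_of_real (d j) *s v j"
    and "\<forall>i\<in>UNIV. \<forall>j\<in>UNIV. cip (v i) (v j) = (if i = j then 1 else 0)"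
    using exists_orthonormal_eigenvectors[of UNIV B] by (elim exE conjE)
  then have d: "\<And>j. 0 \<le> d j"
    and eig: "\<And>j. (mat_adj B ** B) *v v j = complex_of_real (d j) *s v j"
    and v: "\<And>i j. cip (v i) (v j) = (if i = j then 1 else 0)"
    by simp_all
  define U where "U = (\<chi> a i. v i $ a)"
  have UU: "mat_adj U ** U = mat 1"
    using v by (simp add: vec_eq_iff matrix_matrix_mult_def mat_adj_nth U_def mat_def cip_def)
  then have UU': "U ** mat_adj U = mat 1"
    using matrix_left_right_inverse by blast
  have "(mat_adj B ** B) ** U = U ** diag_mat d"
  proof -
    have "((mat_adj B ** B) ** U) $ a $ i = ((mat_adj B ** B) *v v i) $ a" for a i
      by (simp add: matrix_matrix_mult_def matrix_vector_mult_def U_def)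
    then show ?thesis
      by (simp add: vec_eq_iff eig mult_diag_mat U_def mult.commute)
  qed
  then have "mat_adj B ** B = U ** diag_mat d ** mat_adj U"
    using UU' by (metis matrix_mul_assoc matrix_mul_rid)
  then show ?thesis
    using that[of U d] UU UU' d by (simp add: unitary_mat_def)
qed

text \<open>By \<open>psd_powr_rel_unique\<close> the definite description may be evaluated in any
  diagonalization at hand.\<close>

lemma psd_powr_eq:
  assumes "unitary_mat U" and "\<And>i. 0 \<le> d i"
  shows "psd_powr (U ** diag_mat d ** mat_adj U) r
    = U ** diag_mat (\<lambda>i. d i powr r) ** mat_adj U"
proof -
  have "psd_powr_rel (U ** diag_mat d ** mat_adj U) r
      (U ** diag_mat (\<lambda>i. d i powr r) ** mat_adj U)"
    using assms unfolding psd_powr_rel_def by blast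
  then show ?thesis
    unfolding psd_powr_def by (intro the_equality) (auto intro: psd_powr_rel_unique)
qed

text \<open>The same \<open>U\<close> diagonalizes \<open>mat_abs B\<close>, with eigenvalues
  \<open>d i powr (1/2)\<close>, so the exponents \<open>1/2\<close> and \<open>p\<close>
  multiply.\<close>

lemma psd_powr_mat_abs:
  assumes "unitary_mat U" and "\<And>i. 0 \<le> d i" and "mat_adj B ** B = U ** diag_mat d ** mat_adj U"
  shows "psd_powr (mat_abs B) p = U ** diag_mat (\<lambda>i. d i powr (p / 2)) ** mat_adj U"
  using assms by (simp add: mat_abs_def psd_powr_eq powr_powr)

section \<open>Operator norm and the best approximation by scalar matrices\<close>

lemma norm_matrix_vector_le_op_norm: "norm (A *v x) \<le> op_norm A * norm x"
  unfolding op_norm_def by (rule onorm[OF matrix_vector_mul_bounded_linear])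

lemma op_norm_nonneg: "0 \<le> op_norm A"
  unfolding op_norm_def by (rule onorm_pos_le[OF matrix_vector_mul_bounded_linear])

lemma mat_mult_vector: "mat c *v x = c *s x"
  by (simp add: vec_eq_iff matrix_vector_mult_def mat_def if_distrib if_distribR cong: if_cong)

lemma norm_complex_scale: "norm (c *s x) = cmod c * norm (x :: complex^'n)"
  by (simp add: norm_vec_def norm_mult L2_set_right_distrib)

lemma op_norm_mat: "op_norm (mat c :: complex^'n^'n) = cmod c"
proof (rule antisym)
  show "op_norm (mat c :: complex^'n^'n) \<le> cmod c"
    unfolding op_norm_def
    by (rule onorm_bound) (simp_all add: mat_mult_vector norm_complex_scale)
  have "norm ((mat c :: complex^'n^'n) *v axis undefined 1) \<le> op_norm (mat c :: complex^'n^'n)"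
    using norm_matrix_vector_le_op_norm[of "mat c" "axis undefined 1 :: complex^'n"] by simp
  then show "cmod c \<le> op_norm (mat c :: complex^'n^'n)"
    by (simp add: mat_mult_vector norm_complex_scale)
qed

lemma op_norm_diff_le: "op_norm (A - C) \<le> op_norm A + op_norm C"
  unfolding op_norm_def
proof (rule onorm_bound)
  fix x
  have "norm ((A - C) *v x) \<le> norm (A *v x) + norm (C *v x)"
    by (simp add: matrix_vector_mult_diff_rdistrib norm_triangle_ineq4)
  also have "\<dots> \<le> (onorm ((*v) A) + onorm ((*v) C)) * norm x"
    using norm_matrix_vector_le_op_norm[of A x] norm_matrix_vector_le_op_norm[of C x]
    by (simp add: op_norm_def algebra_simps)
  finally show "norm ((A - C) *v x) \<le> (onorm ((*v) A) + onorm ((*v) C)) * norm x" .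
qed (use op_norm_nonneg[of A] op_norm_nonneg[of C] in \<open>simp add: op_norm_def\<close>)

lemma mat_diff: "mat a - mat b = (mat (a - b) :: 'a::ab_group_add^'n^'n)"
  by (simp add: vec_eq_iff mat_def)

text \<open>Continuity and coercivity: outside the ball of radius \<open>2 * op_norm A\<close> the
  distance exceeds \<open>op_norm A\<close>, its value at \<open>w = 0\<close>, so a minimizer over
  that compact ball is a global one.\<close>

lemma exists_arg_min_op_norm_diff_mat:
  fixes A :: "complex^'n^'n"
  obtains z where "is_arg_min (\<lambda>w. op_norm (A - mat w)) (\<lambda>_. True) z"
proof -
  \<comment> \<open>Lipschitz constant 1, from the triangle inequality and
    \<open>op_norm_mat\<close>; this allows \<open>d = e\<close> in the continuity proof
    below.\<close>
  have lip: "\<bar>op_norm (A - mat w) - op_norm (A - mat w')\<bar> \<le> cmod (w - w')" for w w'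
  proof -
    have "op_norm (A - mat b) \<le> op_norm (A - mat a) + cmod (a - b)" for a b
    proof -
      have "A - mat b = A - mat a - mat (b - a)"
        by (simp flip: mat_diff)
      moreover have "op_norm (mat (b - a) :: complex^'n^'n) = cmod (a - b)"
        by (simp add: op_norm_mat norm_minus_commute)
      ultimately show ?thesis
        using op_norm_diff_le[of "A - mat a" "mat (b - a)"] by metis
    qed
    from this[of w w'] this[of w' w] show ?thesis
      by (simp add: norm_minus_commute abs_le_iff)
  qed
  have "continuous_on (cball 0 (2 * op_norm A)) (\<lambda>w. op_norm (A - mat w))"
    unfolding continuous_on_iff dist_norm real_norm_def
  proof (intro ballI allI impI)
    fix w :: complex and e :: real
    assume "0 < e"
    then show "\<exists>d>0. \<forall>w'\<in>cball 0 (2 * op_norm A). cmod (w' - w) < d \<longrightarrow>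
        \<bar>op_norm (A - mat w') - op_norm (A - mat w)\<bar> < e"
      using lip by (intro exI[of _ e]) (auto intro: le_less_trans)
  qed
  then obtain z where z: "\<And>w. cmod w \<le> 2 * op_norm A \<Longrightarrow> op_norm (A - mat z) \<le> op_norm (A - mat w)"
    using continuous_attains_inf[of "cball (0::complex) (2 * op_norm A)" "\<lambda>w. op_norm (A - mat w)"]
      op_norm_nonneg[of A] by (auto simp: Ball_def)
  have "op_norm (A - mat z) \<le> op_norm (A - mat w)" for w
  proof (cases "cmod w \<le> 2 * op_norm A")
    case False
    have "cmod w \<le> op_norm A + op_norm (A - mat w)"
      using op_norm_diff_le[of A "A - mat w"] by (simp add: op_norm_mat)
    moreover have "op_norm (A - mat z) \<le> op_norm A"
      using z[of 0] op_norm_nonneg[of A] by (simp add: mat_def zero_vec_def[symmetric])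
    ultimately show ?thesis using False by simp
  qed (rule z)
  then show ?thesis
    using that by (auto simp: is_arg_min_linorder)
qed

section \<open>Jensen's inequality for powers with exponent at most 1\<close>

lemma powr_weighted_sum_le:
  fixes w d :: "'i \<Rightarrow> real"
  assumes "finite I" and w: "\<And>i. i \<in> I \<Longrightarrow> 0 \<le> w i" and d: "\<And>i. i \<in> I \<Longrightarrow> 0 \<le> d i"
    and "sum w I = 1" and "0 < q" and "q \<le> 1"
  shows "(\<Sum>i\<in>I. d i powr q * w i) \<le> (\<Sum>i\<in>I. d i * w i) powr q"
proof -
  define s where "s = (\<Sum>i\<in>I. d i * w i)"
  have "0 \<le> s" unfolding s_def by (intro sum_nonneg mult_nonneg_nonneg w d)
  show ?thesis
  proof (cases "s = 0")
    \<comment> \<open>A vanishing mean forces \<open>d i = 0\<close> wherever \<open>w i\<close> is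
      nonzero, and \<open>0 powr q = 0\<close>.\<close>
    case True
    then have "d i * w i = 0" if "i \<in> I" for i
      using assms(1) that w d unfolding s_def by (subst (asm) sum_nonneg_eq_0_iff) auto
    then have "(\<Sum>i\<in>I. d i powr q * w i) = 0"
      by (intro sum.neutral) auto
    then show ?thesis using True by (simp add: s_def)
  next
    case False
    then have s: "0 < s" using \<open>0 \<le> s\<close> by simp
    \<comment> \<open>Young's inequality compares each \<open>d i\<close> with the mean
      \<open>s\<close>, and averaging over the weights turns its right-hand side into
      \<open>s\<close>. The factor \<open>s powr (1 - q)\<close> is cancelled at the end.\<close>
    have "s powr (1 - q) * (\<Sum>i\<in>I. d i powr q * w i)
        = (\<Sum>i\<in>I. (d i powr q * s powr (1 - q)) * w i)"
      by (simp add: sum_distrib_left mult_ac)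
    also have "\<dots> \<le> (\<Sum>i\<in>I. (q * d i + (1 - q) * s) * w i)"
    proof (intro sum_mono mult_right_mono w)
      fix i assume "i \<in> I"
      then show "d i powr q * s powr (1 - q) \<le> q * d i + (1 - q) * s"
        using d[of i] assms s Youngs_inequality_0[of q "1 - q" "d i" s] by (cases "d i = 0") (auto simp: less_le)
    qed
    also have "\<dots> = q * s + (1 - q) * s * sum w I"
      by (simp add: s_def distrib_right sum.distrib sum_distrib_left mult.assoc)
    also have "\<dots> = s powr (1 - q) * s powr q"
      using assms s by (simp add: algebra_simps flip: powr_add)
    finally show ?thesis
      using s by (simp add: s_def)
  qed
qed

section \<open>Positive functionals and shifts by scalar matrices\<close>

lemma matrix_diff_ldistrib: "(A :: 'a::ring_1^'n^'m) ** (B - C) = A ** B - A ** C"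
  by (simp add: vec_eq_iff matrix_matrix_mult_def right_diff_distrib sum_subtractf)

lemma matrix_diff_rdistrib: "(A - B) ** (C :: 'a::ring_1^'n^'m) = A ** C - B ** C"
  by (simp add: vec_eq_iff matrix_matrix_mult_def left_diff_distrib sum_subtractf)

lemma mat_adj_diff: "mat_adj (A - C) = mat_adj A - mat_adj C"
  by (simp add: vec_eq_iff mat_adj_nth)

lemma mat_adj_mat: "mat_adj (mat c) = mat (cnj c)"
  by (auto simp: vec_eq_iff mat_adj_nth mat_def)

lemma mat_mult_left: "mat c ** A = map_matrix ((*) c) A"
  by (simp add: vec_eq_iff map_matrix_def matrix_matrix_mult_def mat_def if_distrib if_distribR cong: if_cong)

lemma mat_mult_right: "A ** mat c = map_matrix ((*) c) (A :: 'a::comm_semiring_1^'n^'m)"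
  by (simp add: vec_eq_iff map_matrix_def matrix_matrix_mult_def mat_def if_distrib if_distribR mult.commute cong: if_cong)

text \<open>A state without its norm condition. The value \<open>\<omega> (mat 1) = 1\<close> is
  kept out because its derivation in \<open>is_state_one\<close> relies on \<open>norm_le\<close>,
  proved in this locale.\<close>

locale positive_functional =
  fixes \<omega> :: "complex^'n^'n \<Rightarrow> complex"
  assumes add: "\<omega> (A + C) = \<omega> A + \<omega> C"
    and scale: "\<omega> (map_matrix ((*) c) A) = c * \<omega> A"
    and pos: "psd_mat A \<Longrightarrow> \<omega> A \<in> \<real>\<^sub>\<ge>\<^sub>0"
begin

lemma zero: "\<omega> 0 = 0"
  using add[of 0 0] by simp

lemma diff: "\<omega> (A - C) = \<omega> A - \<omega> C"
  using add[of "A - C" C] by simp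

lemma sum: "\<omega> (\<Sum>i\<in>I. F i) = (\<Sum>i\<in>I. \<omega> (F i))"
  by (induction I rule: infinite_finite_induct) (simp_all add: zero add)

lemma mat: "\<omega> (mat c) = c * \<omega> (mat 1)"
  using scale[of c "mat 1"] by (simp flip: mat_mult_left)

lemma one_nonneg: "\<omega> (mat 1) \<in> \<real>\<^sub>\<ge>\<^sub>0"
  by (rule pos) (simp add: psd_mat_cip cip_self)

lemma gram_nonneg: "0 \<le> Re (\<omega> (mat_adj A ** A))"
  using pos[OF psd_mat_gram[of A]] by (simp add: complex_nonneg_Reals_iff)

text \<open>The value at the adjoint stays unevaluated, since the lemma \<open>mat_adj\<close> is
  derived from this expansion.\<close>

lemma gram_diff_mat_raw:
  "\<omega> (mat_adj (A - mat c) ** (A - mat c))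
    = \<omega> (mat_adj A ** A) - c * \<omega> (mat_adj A) - cnj c * \<omega> A + c * cnj c * \<omega> (mat 1)"
proof -
  have "mat_adj (A - mat c) ** (A - mat c)
      = mat_adj A ** A - mat_adj A ** mat c - (mat (cnj c) ** A - mat (cnj c) ** mat c)"
    by (simp add: mat_adj_diff mat_adj_mat matrix_diff_ldistrib matrix_diff_rdistrib)
  moreover have "\<omega> (mat (cnj c) ** mat c) = cnj c * (c * \<omega> (mat 1))"
    by (simp add: mat_mult_left scale mat[of c])
  ultimately show ?thesis
    by (simp only:) (simp add: diff scale mat_mult_left[of _ A] mat_mult_right[of "mat_adj A"])
qed

text \<open>Polarization: the expansion is real for every \<open>c\<close>. Taking
  \<open>c = 1\<close> compares the imaginary parts of the two sides, \<open>c = \<i>\<close> the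
  real parts, and \<open>c = 0\<close> disposes of the constant term.\<close>

lemma mat_adj: "\<omega> (mat_adj A) = cnj (\<omega> A)"
proof -
  have "Im (\<omega> (mat_adj A ** A) - c * \<omega> (mat_adj A) - cnj c * \<omega> A + c * cnj c * \<omega> (mat 1)) = 0" for c
    using pos[OF psd_mat_gram, of "A - mat c"]
    by (simp only: gram_diff_mat_raw complex_nonneg_Reals_iff)
  from this[of 0] this[of 1] this[of \<i>] show ?thesis
    using one_nonneg by (simp add: complex_eq_iff complex_nonneg_Reals_iff)
qed

text \<open>The two cross terms are conjugate, so their sum is real. This quadratic in
  \<open>c\<close> serves both Cauchy-Schwarz in \<open>norm_le\<close> and the variance
  identity.\<close>

lemma gram_diff_mat:
  "\<omega> (mat_adj (A - mat c) ** (A - mat c))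
    = \<omega> (mat_adj A ** A) - complex_of_real (2 * Re (cnj c * \<omega> A)) + complex_of_real ((cmod c)\<^sup>2) * \<omega> (mat 1)"
  unfolding gram_diff_mat_raw mat_adj
  by (simp add: complex_eq_iff cmod_power2) (simp add: power2_eq_square)

text \<open>Positivity is applied to \<open>(op_norm A)\<^sup>2\<close> times the identity minus
  \<open>mat_adj A ** A\<close>, whose quadratic form is nonnegative by the definition of the
  operator norm.\<close>

lemma gram_le: "Re (\<omega> (mat_adj A ** A)) \<le> (op_norm A)\<^sup>2 * Re (\<omega> (mat 1))"
proof -
  have "psd_mat (mat (complex_of_real ((op_norm A)\<^sup>2)) - mat_adj A ** A)"
    unfolding psd_mat_cip
  proof
    fix x
    have "(norm (A *v x))\<^sup>2 \<le> (op_norm A * norm x)\<^sup>2"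
      by (intro power_mono norm_matrix_vector_le_op_norm) simp
    then show "cip x ((mat (complex_of_real ((op_norm A)\<^sup>2)) - mat_adj A ** A) *v x) \<in> \<real>\<^sub>\<ge>\<^sub>0"
      by (simp add: matrix_vector_mult_diff_rdistrib cip_diff_right cip_gram mat_mult_vector
          cip_scale_right cip_self complex_nonneg_Reals_iff power_mult_distrib
          flip: of_real_mult of_real_diff of_real_power)
  qed
  from pos[OF this] show ?thesis
    by (simp add: diff mat[of "complex_of_real _"] complex_nonneg_Reals_iff flip: of_real_power)
qed

text \<open>Cauchy-Schwarz between \<open>A\<close> and the identity in discriminant form: shifting
  \<open>A\<close> by the scalar \<open>t * \<omega> A\<close> with real \<open>t\<close> turns
  positivity into a quadratic inequality in \<open>t\<close>.\<close>

lemma norm_le: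
  assumes "op_norm A \<le> 1"
  shows "cmod (\<omega> A) \<le> Re (\<omega> (mat 1))"
proof -
  define s r where "s = Re (\<omega> (mat 1))" and "r = cmod (\<omega> A)"
  have s: "0 \<le> s" using one_nonneg by (simp add: s_def complex_nonneg_Reals_iff)
  have "Re (\<omega> (mat_adj A ** A)) \<le> (op_norm A)\<^sup>2 * s"
    using gram_le by (simp add: s_def)
  also have "\<dots> \<le> s"
    using assms s op_norm_nonneg[of A] by (simp add: mult_left_le_one_le power_le_one)
  finally have gram: "Re (\<omega> (mat_adj A ** A)) \<le> s" .
  have quad: "0 \<le> s - 2 * t * r\<^sup>2 + t\<^sup>2 * r\<^sup>2 * s" for t
  proof -
    have "0 \<le> Re (\<omega> (mat_adj (A - mat (of_real t * \<omega> A)) ** (A - mat (of_real t * \<omega> A))))"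
      by (rule gram_nonneg)
    also have "\<dots> = Re (\<omega> (mat_adj A ** A)) - 2 * t * r\<^sup>2 + t\<^sup>2 * r\<^sup>2 * s"
      unfolding gram_diff_mat
      by (simp add: s_def r_def norm_mult power_mult_distrib cmod_power2) (simp add: power2_eq_square algebra_simps)
    finally show ?thesis using gram by simp
  qed
  show ?thesis
  proof (cases "s = 0")
    case True
    then have "r\<^sup>2 \<le> 0" using quad[of 1] by simp
    then show ?thesis using True by (simp add: s_def r_def)
  next
    case False
    \<comment> \<open>The quadratic is smallest at \<open>t = 1 / s\<close>, with value
      \<open>s - r\<^sup>2 / s\<close>.\<close>
    then have "r\<^sup>2 \<le> s\<^sup>2" using quad[of "1 / s"] s by (simp add: field_simps power2_eq_square)
    then have "r \<le> s" using s by (rule power2_le_imp_le)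
    then show ?thesis by (simp only: s_def r_def)
  qed
qed

text \<open>On these matrices \<open>\<omega>\<close> acts as a finite measure: \<open>w i\<close>
  is its value at the rank-one positive semidefinite matrix \<open>Q i\<close> built from column
  \<open>i\<close> of \<open>U\<close>.\<close>

lemma conjugated_diag_mat:
  obtains w where "\<And>i. 0 \<le> w i"
    and "\<And>f. \<omega> (U ** diag_mat f ** mat_adj U) = complex_of_real (\<Sum>i\<in>UNIV. f i * w i)"
proof -
  define Q where "Q i = (\<chi> a b. U $ a $ i * cnj (U $ b $ i))" for i
  have "cip x (Q i *v x) = complex_of_real ((cmod (cip x (column i U)))\<^sup>2)" for i x
  proof -
    have "Q i *v x = cip (column i U) x *s column i U"
      by (simp add: vec_eq_iff Q_def matrix_vector_mult_def cip_def column_def sum_distrib_right sum_distrib_left mult_ac)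
    then show ?thesis
      using cip_commute[of "column i U" x]
      by (simp add: cip_scale_right mult.commute flip: complex_norm_square)
  qed
  then have "psd_mat (Q i)" for i
    by (simp add: psd_mat_cip)
  then have Q: "\<omega> (Q i) \<in> \<real>\<^sub>\<ge>\<^sub>0" for i by (rule pos)
  have "U ** diag_mat f ** mat_adj U = (\<Sum>i\<in>UNIV. map_matrix ((*) (complex_of_real (f i))) (Q i))" for f
    by (simp add: vec_eq_iff matrix_matrix_mult_def[of "U ** diag_mat f"] mult_diag_mat
        mat_adj_nth Q_def map_matrix_def mult_ac)
  then have "\<omega> (U ** diag_mat f ** mat_adj U) = complex_of_real (\<Sum>i\<in>UNIV. f i * Re (\<omega> (Q i)))" for f
    using Q by (simp add: sum scale complex_nonneg_Reals_iff complex_eq_iff)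
  then show ?thesis
    using that[of "\<lambda>i. Re (\<omega> (Q i))"] Q by (simp add: complex_nonneg_Reals_iff)
qed

text \<open>In an eigenbasis of \<open>mat_adj B ** B\<close> the values of \<open>\<omega>\<close>
  are weighted means over eigenvalues, so \<open>powr_weighted_sum_le\<close> applies with
  \<open>q = p / 2\<close>. The second claim lets the theorem take the power \<open>1 / p\<close>
  monotonically.\<close>

lemma psd_powr_mat_abs_le:
  assumes one: "\<omega> (mat 1) = 1" and p: "0 < p" "p \<le> 2"
  shows "Re (\<omega> (psd_powr (mat_abs B) p)) \<le> Re (\<omega> (mat_adj B ** B)) powr (p / 2)"
    and "0 \<le> Re (\<omega> (psd_powr (mat_abs B) p))"
proof -
  obtain U d where U: "unitary_mat U" and d: "\<And>i. 0 \<le> d i"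
    and B: "mat_adj B ** B = U ** diag_mat d ** mat_adj U"
    using gram_diagonalization[of B] by metis
  obtain w where w: "\<And>i. 0 \<le> w i"
    and \<omega>: "\<And>f. \<omega> (U ** diag_mat f ** mat_adj U) = complex_of_real (\<Sum>i\<in>UNIV. f i * w i)"
    using conjugated_diag_mat[of U] by metis
  \<comment> \<open>Constant eigenvalue 1 gives the identity, so the weights have total mass
    \<open>\<omega> (mat 1) = 1\<close>.\<close>
  have "diag_mat (\<lambda>i. 1) = (mat 1 :: complex^'n^'n)"
    by (simp add: vec_eq_iff diag_mat_def mat_def)
  then have "complex_of_real (sum w UNIV) = 1"
    using \<omega>[of "\<lambda>i. 1"] U one by (simp add: unitary_mat_def)
  then have "sum w UNIV = 1"
    using of_real_eq_1_iff by blast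
  then show "Re (\<omega> (psd_powr (mat_abs B) p)) \<le> Re (\<omega> (mat_adj B ** B)) powr (p / 2)"
    unfolding psd_powr_mat_abs[OF U d B] B \<omega>
    using w d p by (simp add: powr_weighted_sum_le del: of_real_sum)
  show "0 \<le> Re (\<omega> (psd_powr (mat_abs B) p))"
    unfolding psd_powr_mat_abs[OF U d B] \<omega> using w by (simp add: sum_nonneg)
qed

end

section \<open>Normalization of states and the final inequality\<close>

lemma is_state_positive_functional: "is_state \<omega> \<Longrightarrow> positive_functional \<omega>"
  by unfold_locales (auto simp: is_state_def Vector_Spaces.linear_iff)

text \<open>By \<open>norm_le\<close> the supremum 1 is at most
  \<open>Re (\<omega> (mat 1))\<close>, while \<open>mat 1\<close> lies in the unit ball, so
  \<open>cmod (\<omega> (mat 1)) \<le> 1\<close>.\<close>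

lemma is_state_one:
  fixes \<omega> :: "complex^'n^'n \<Rightarrow> complex"
  assumes "is_state \<omega>"
  shows "\<omega> (mat 1) = 1"
proof -
  interpret positive_functional \<omega> by (rule is_state_positive_functional[OF assms])
  have sup: "(SUP A\<in>{A. op_norm A \<le> 1}. cmod (\<omega> A)) = 1"
    using assms by (simp add: is_state_def)
  have one: "mat 1 \<in> {A :: complex^'n^'n. op_norm A \<le> 1}"
    by (simp add: op_norm_mat)
  \<comment> \<open>A real \<open>SUP\<close> is known to dominate its members only when the set is
    bounded above.\<close>
  have "bdd_above ((\<lambda>A. cmod (\<omega> A)) ` {A. op_norm A \<le> 1})"
    using norm_le by (auto intro!: bdd_aboveI)
  then have "cmod (\<omega> (mat 1)) \<le> 1"
    using cSUP_upper[OF one] sup by metis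
  moreover have "(SUP A\<in>{A. op_norm A \<le> 1}. cmod (\<omega> A)) \<le> Re (\<omega> (mat 1))"
    using one norm_le by (intro cSUP_least) auto
  ultimately show ?thesis
    using sup one_nonneg complex_Re_le_cmod[of "\<omega> (mat 1)"]
    by (simp add: complex_nonneg_Reals_iff complex_eq_iff)
qed

theorem mainTheorem3:
  fixes \<omega> :: "complex^'n^'n \<Rightarrow> complex" and A :: "complex^'n^'n" and p :: real
  assumes "is_state \<omega>" and "1 \<le> p" and "p \<le> 2"
  shows "\<exists>z. is_arg_min (\<lambda>w. op_norm (A - mat w)) (\<lambda>_. True) z \<and>
           Re (\<omega> (psd_powr (mat_abs (A - mat (\<omega> A))) p)) powr (1 / p) \<le> op_norm (A - mat z)"
proof -
  interpret positive_functional \<omega> by (rule is_state_positive_functional[OF assms(1)])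
  have one: "\<omega> (mat 1) = 1" by (rule is_state_one[OF assms(1)])
  define B where "B = A - mat (\<omega> A)"
  have variance: "Re (\<omega> (mat_adj B ** B)) \<le> (op_norm (A - mat z))\<^sup>2" for z
  proof -
    have "Re (\<omega> (mat_adj B ** B)) + (cmod (z - \<omega> A))\<^sup>2
        = Re (\<omega> (mat_adj (A - mat z) ** (A - mat z)))"
      unfolding B_def gram_diff_mat one by (simp add: cmod_power2) (simp add: power2_eq_square algebra_simps)
    also have "\<dots> \<le> (op_norm (A - mat z))\<^sup>2"
      using gram_le[of "A - mat z"] by (simp add: one)
    finally show ?thesis by (smt (verit) zero_le_power2)
  qed
  have "Re (\<omega> (psd_powr (mat_abs B) p)) powr (1 / p)
      \<le> (Re (\<omega> (mat_adj B ** B)) powr (p / 2)) powr (1 / p)"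
    using assms by (intro powr_mono2 psd_powr_mat_abs_le one) auto
  also have "\<dots> = sqrt (Re (\<omega> (mat_adj B ** B)))"
    using assms gram_nonneg[of B] by (simp add: powr_powr powr_half_sqrt)
  finally have "Re (\<omega> (psd_powr (mat_abs B) p)) powr (1 / p) \<le> sqrt (Re (\<omega> (mat_adj B ** B)))" .
  \<comment> \<open>The bound holds for every scalar \<open>z\<close>, hence also for the minimizer
    obtained next.\<close>
  moreover have "sqrt (Re (\<omega> (mat_adj B ** B))) \<le> op_norm (A - mat z)" for z
    using variance by (simp add: real_le_lsqrt op_norm_nonneg)
  moreover obtain z where "is_arg_min (\<lambda>w. op_norm (A - mat w)) (\<lambda>_. True) z"
    by (rule exists_arg_min_op_norm_diff_mat)
  ultimately show ?thesis
    unfolding B_def by (intro exI[of _ z] conjI) (auto intro: order_trans)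
qed

end
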